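(* Let $m\ge 2$ be an integer and let $\mathbf{k}=(k_0,k_1,k_2,\ldots)$ be a sequence of positive integers. For an integer $n\ge 0$, suppose that the base $m$ representation of $n$ is given by $$n=d_0+d_1m+\cdots+d_tm^t,\qquad t\ge 0,$$ with $0\le d_j\le m-1$ for $0\le j\le t$. If $m$ is relatively prime to $(k_0-1)!$ and to $k_j!$ for all $j\ge 1$, then $$b^{(\mathbf{k})}_m(n)\equiv\binom{k_0-1+d_0}{k_0-1}\prod_{j=1}^{t}\binom{k_j+d_j}{k_j}\pmod m,$$ where $b^{(\mathbf{k})}_m(n)$ is the number of $\mathbf{k}$-coloured $m$-ary partitions of $n$.
   Context: An $m$-ary partition of a nonnegative integer $n$ is an integer partition of $n$ in which each part is a nonnegative integer power of the fixed integer $m\ge 2$. Given a sequence $\mathbf{k}=(k_0,k_1,\ldots)$ of positive integers, an $m$-ary partition is $\mathbf{k}$-coloured when there are $k_j$ colours for the part $m^j$, for each $j\ge 0$; that is, there are $k_j$ different kinds of parts of the same size $m^j$ (so a $\mathbf{k}$-coloured $m$-ary partition of $n$ is a finite multiset of pairs $(j,c)$ with $j\ge 0$, $1\le c\le k_j$, whose sizes $m^j$ sum to $n$). $b^{(\mathbf{k})}_m(n)$ denotes the number of $\mathbf{k}$-coloured $m$-ary partitions of $n$; equivalently $\sum_{n\ge 0} b^{(\mathbf{k})}_m(n)q^n=\prod_{j\ge 0}(1-q^{m^j})^{-k_j}$. Empty products equal $1$. *)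

theory Defs
  imports "HOL-Library.Multiset" "HOL-Number_Theory.Cong"
begin

text \<open>
  The pair \<open>(j, c)\<close> stands for a part of size \<open>m ^ j\<close> in colour \<open>c\<close>. Recording the exponent
  rather than the size itself is unambiguous as long as \<open>m \<ge> 2\<close>.
\<close>

definition coloured_mary_partitions :: "nat \<Rightarrow> (nat \<Rightarrow> nat) \<Rightarrow> nat \<Rightarrow> (nat \<times> nat) multiset set" where
  "coloured_mary_partitions m k n =
     {P. (\<forall>(j, c) \<in> set_mset P. 1 \<le> c \<and> c \<le> k j) \<and> (\<Sum>(j, c)\<in>#P. m ^ j) = n}"

definition num_coloured_mary_partitions :: "nat \<Rightarrow> (nat \<Rightarrow> nat) \<Rightarrow> nat \<Rightarrow> nat" where
  "num_coloured_mary_partitions m k n = card (coloured_mary_partitions m k n)"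

text \<open>For \<open>m \<ge> 2\<close> the cardinality above is that of a finite set.\<close>

lemma finite_coloured_mary_partitions:
  assumes "m \<ge> 2"
  shows "finite (coloured_mary_partitions m k n)"
proof (rule finite_subset)
  let ?A = "Sigma {..n} (\<lambda>j. {1..k j})"
  show "finite (mset ` {xs. set xs \<subseteq> ?A \<and> length xs \<le> n})"
    by (intro finite_imageI finite_lists_length_le) auto
  show "coloured_mary_partitions m k n \<subseteq> mset ` {xs. set xs \<subseteq> ?A \<and> length xs \<le> n}"
  proof
    fix P assume P: "P \<in> coloured_mary_partitions m k n"
    obtain xs where xs: "mset xs = P" using ex_mset by blast
    have sum: "(\<Sum>(j, c)\<in>#P. m ^ j) = n"
      and col: "\<And>j c. (j, c) \<in># P \<Longrightarrow> 1 \<le> c \<and> c \<le> k j"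
      using P by (auto simp: coloured_mary_partitions_def)
    have size: "size Q \<le> (\<Sum>(j, c)\<in>#Q. m ^ j)" for Q :: "(nat \<times> nat) multiset"
    proof (induction Q)
      case (add x Q)
      have "1 \<le> m ^ fst x" using assms by simp
      then show ?case using add by (simp add: case_prod_beta)
    qed simp
    have "j \<le> n" if "(j, c) \<in># P" for j c
    proof -
      obtain Q where "P = add_mset (j, c) Q" using \<open>(j, c) \<in># P\<close> by (meson multi_member_split)
      then have "m ^ j \<le> n" using sum by auto
      moreover have "j < m ^ j" using assms by (intro power_gt_expt) simp_all
      ultimately show ?thesis by simp
    qed
    then have "set xs \<subseteq> ?A" using col xs by auto
    moreover have "length xs \<le> n" using size[of P] sum xs by auto
    ultimately show "P \<in> mset ` {xs. set xs \<subseteq> ?A \<and> length xs \<le> n}" using xs by auto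
  qed
qed

end

theory Submission
  imports Defs
begin

text \<open>
  Splitting off the parts of size \<open>1\<close> writes the number of partitions of \<open>n = d\<^sub>0 + m n'\<close> as
  a sum over \<open>a \<le> n'\<close> of \<open>k\<^sub>0 - 1 + d\<^sub>0 + m (n' - a)\<close> choose \<open>k\<^sub>0 - 1\<close> times the number of
  partitions of \<open>a\<close> for the shifted colour sequence. Since \<open>m\<close> is coprime to \<open>(k\<^sub>0 - 1)!\<close>, the
  binomial coefficient is constant modulo \<open>m\<close>. What remains is the sum of the shifted counts
  over \<open>a \<le> n'\<close>, which is the count for \<open>n'\<close> with one additional colour for the parts of size
  \<open>1\<close>; this is a problem of the same kind with one digit fewer.
\<close>

section \<open>Dependence on the number of colours of the part \<open>1\<close>\<close>

lemma num_coloured_mary_partitions_0: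
  assumes "m > 0"
  shows "num_coloured_mary_partitions m k 0 = 1"
proof -
  have "P = {#}" if "(\<Sum>(j, c)\<in>#P. m ^ j) = 0" for P :: "(nat \<times> nat) multiset"
    using that assms by (cases P) auto
  then have "coloured_mary_partitions m k 0 = {{#}}"
    by (auto simp: coloured_mary_partitions_def)
  then show ?thesis
    by (simp add: num_coloured_mary_partitions_def)
qed

text \<open>Either the last colour of the part \<open>1\<close> does not occur, or one copy of it
  can be removed, which lowers the sum by one.\<close>

lemma num_coloured_mary_partitions_Suc:
  assumes "m \<ge> 2"
  shows "num_coloured_mary_partitions m (k(0 := Suc K)) (Suc n) =
         num_coloured_mary_partitions m (k(0 := K)) (Suc n) +
         num_coloured_mary_partitions m (k(0 := Suc K)) n"
proof -
  let ?x = "(0, Suc K)"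
  let ?C = "coloured_mary_partitions m"
  let ?A = "?C (k(0 := K)) (Suc n)" and ?B = "?C (k(0 := Suc K)) n"
  have without: "P \<in> ?A \<longleftrightarrow> P \<in> ?C (k(0 := Suc K)) (Suc n) \<and> ?x \<notin># P" for P
  proof -
    \<comment> \<open>Raising the number of colours of the part \<open>1\<close> from
      \<open>K\<close> to \<open>Suc K\<close> admits exactly one new pair,
      \<open>?x\<close>.\<close>
    have "(case y of (j, c) \<Rightarrow> 1 \<le> c \<and> c \<le> (k(0 := K)) j) \<longleftrightarrow>
          (case y of (j, c) \<Rightarrow> 1 \<le> c \<and> c \<le> (k(0 := Suc K)) j) \<and> y \<noteq> ?x" for y
      by (cases y) auto
    then show ?thesis
      by (auto simp: coloured_mary_partitions_def)
  qed
  have add: "add_mset ?x P \<in> ?C (k(0 := Suc K)) (Suc n) \<longleftrightarrow> P \<in> ?B" for P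
    by (auto simp: coloured_mary_partitions_def)
  have "?C (k(0 := Suc K)) (Suc n) = ?A \<union> add_mset ?x ` ?B"
  proof (intro set_eqI iffI)
    fix P assume P: "P \<in> ?C (k(0 := Suc K)) (Suc n)"
    show "P \<in> ?A \<union> add_mset ?x ` ?B"
    proof (cases "?x \<in># P")
      case True
      then obtain Q where "P = add_mset ?x Q" by (meson multi_member_split)
      then show ?thesis using P add by blast
    next
      case False
      then show ?thesis using P without by blast
    qed
  qed (use without add in blast)
  moreover have "?A \<inter> add_mset ?x ` ?B = {}"
    using without by auto
  ultimately have "card (?C (k(0 := Suc K)) (Suc n)) = card ?A + card (add_mset ?x ` ?B)"
    using finite_coloured_mary_partitions[OF assms] by (simp add: card_Un_disjoint)
  also have "card (add_mset ?x ` ?B) = card ?B"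
    by (intro card_image) (simp add: inj_on_def)
  finally show ?thesis
    unfolding num_coloured_mary_partitions_def .
qed

text \<open>If the new colour is used \<open>n - a\<close> times, the remaining parts form a
  partition of \<open>a\<close>. Formally, the recurrence is unrolled down to \<open>0\<close>,
  where both counts are \<open>1\<close>.\<close>

lemma num_coloured_mary_partitions_add_colour:
  assumes "m \<ge> 2"
  shows "num_coloured_mary_partitions m (k(0 := Suc K)) n =
         (\<Sum>a\<le>n. num_coloured_mary_partitions m (k(0 := K)) a)"
  using assms
  by (induction n) (simp_all add: num_coloured_mary_partitions_0 num_coloured_mary_partitions_Suc)

text \<open>The parts larger than \<open>1\<close> sum to \<open>a\<close>; the binomial coefficient
  counts the ways to distribute the remaining \<open>n - a\<close> ones among \<open>Suc K\<close>
  colours. The induction matches the recurrence with Pascal's rule.\<close>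

lemma num_coloured_mary_partitions_eq_sum:
  assumes "m \<ge> 2"
  shows "num_coloured_mary_partitions m (k(0 := Suc K)) n =
         (\<Sum>a\<le>n. ((K + (n - a)) choose K) * num_coloured_mary_partitions m (k(0 := 0)) a)"
proof (induction K arbitrary: n)
  case 0
  then show ?case
    using num_coloured_mary_partitions_add_colour[OF assms, of k 0]
    by (simp del: fun_upd_apply)
next
  case (Suc K)
  note colours = Suc.IH
  let ?c = "num_coloured_mary_partitions m (k(0 := 0))"
  show ?case
  proof (induction n)
    case 0
    then show ?case using assms by (simp add: num_coloured_mary_partitions_0)
  next
    case (Suc n)
    have "num_coloured_mary_partitions m (k(0 := Suc (Suc K))) (Suc n) =
        (\<Sum>a\<le>Suc n. ((K + (Suc n - a)) choose K) * ?c a) +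
        (\<Sum>a\<le>n. ((Suc K + (n - a)) choose Suc K) * ?c a)"
      by (simp only: num_coloured_mary_partitions_Suc[OF assms, of k "Suc K" n] colours Suc.IH)
    \<comment> \<open>The added term at \<open>a = Suc n\<close> is \<open>K choose Suc K\<close>,
      which is \<open>0\<close>. Both sums now have the same range and combine by Pascal's
      rule.\<close>
    also have "(\<Sum>a\<le>n. ((Suc K + (n - a)) choose Suc K) * ?c a) =
        (\<Sum>a\<le>Suc n. ((K + (Suc n - a)) choose Suc K) * ?c a)"
      by (simp add: Suc_diff_le)
    finally show ?case
      by (simp only: add_Suc binomial_Suc_Suc distrib_right sum.distrib)
  qed
qed

section \<open>Splitting off the parts of size \<open>1\<close>\<close>

text \<open>Without colours for the part \<open>1\<close> all exponents are positive, and lowering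
  each by one is a bijection that divides the sum by \<open>m\<close>.\<close>

lemma num_coloured_mary_partitions_shift:
  assumes "m > 0" "k 0 = 0"
  shows "num_coloured_mary_partitions m k (m * n) = num_coloured_mary_partitions m (k \<circ> Suc) n"
proof -
  let ?f = "map_prod Suc id :: nat \<times> nat \<Rightarrow> nat \<times> nat"
  let ?g = "map_prod (\<lambda>j. j - 1) id :: nat \<times> nat \<Rightarrow> nat \<times> nat"
  have sum: "(\<Sum>(j, c)\<in>#image_mset ?f P. m ^ j) = m * (\<Sum>(j, c)\<in>#P. m ^ j)" for P
    by (induction P) (auto simp: distrib_left)
  have mem: "image_mset ?f P \<in> coloured_mary_partitions m k (m * n) \<longleftrightarrow>
      P \<in> coloured_mary_partitions m (k \<circ> Suc) n" for P
  proof -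
    have "(\<forall>(j, c)\<in>set_mset (image_mset ?f P). 1 \<le> c \<and> c \<le> k j) \<longleftrightarrow>
        (\<forall>(j, c)\<in>set_mset P. 1 \<le> c \<and> c \<le> (k \<circ> Suc) j)"
      by (simp add: case_prod_beta)
    then show ?thesis
      unfolding coloured_mary_partitions_def mem_Collect_eq sum using assms(1) by simp
  qed
  have inverse: "P = image_mset ?f (image_mset ?g P)" if "P \<in> coloured_mary_partitions m k (m * n)" for P
  proof -
    have "(?f \<circ> ?g) x = x" if "x \<in># P" for x
    proof -
      \<comment> \<open>Hence the truncated subtraction in \<open>?g\<close> really inverts
        \<open>Suc\<close>.\<close>
      have "fst x \<noteq> 0"
        using \<open>P \<in> _\<close> \<open>x \<in># P\<close> assms(2)
        by (cases x; cases "fst x") (auto simp: coloured_mary_partitions_def)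
      then show ?thesis by (cases x) simp
    qed
    then have "image_mset (?f \<circ> ?g) P = image_mset id P"
      by (intro image_mset_cong) simp
    then show ?thesis
      by (simp add: multiset.map_comp)
  qed
  then have "coloured_mary_partitions m k (m * n) =
      image_mset ?f ` coloured_mary_partitions m (k \<circ> Suc) n"
  proof (intro set_eqI iffI)
    fix P assume P: "P \<in> coloured_mary_partitions m k (m * n)"
    then have "P = image_mset ?f (image_mset ?g P)" by (rule inverse)
    with P mem show "P \<in> image_mset ?f ` coloured_mary_partitions m (k \<circ> Suc) n"
      by (metis imageI)
  qed (use mem in blast)
  moreover have "inj (image_mset ?f)"
    by (intro multiset.inj_map prod.inj_map) simp_all
  ultimately show ?thesis
    by (simp add: num_coloured_mary_partitions_def card_image inj_on_subset)
qed

lemma num_coloured_mary_partitions_not_dvd: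
  assumes "k 0 = 0" "\<not> m dvd n"
  shows "num_coloured_mary_partitions m k n = 0"
proof -
  have "m dvd (\<Sum>(j, c)\<in>#P. m ^ j)" if "\<forall>(j, c)\<in>set_mset P. 1 \<le> c \<and> c \<le> k j" for P
    using that
  proof (induction P)
    case (add x P)
    obtain j c where x: "x = (j, c)" by (cases x)
    with add.prems have "j \<noteq> 0"
      using assms(1) by (cases j) auto
    then have "m dvd m ^ j" by simp
    then show ?case using add x by simp
  qed simp
  then have "coloured_mary_partitions m k n = {}"
    using assms(2) by (auto simp: coloured_mary_partitions_def)
  then show ?thesis
    by (simp add: num_coloured_mary_partitions_def)
qed

text \<open>The parts larger than \<open>1\<close> sum to a multiple of \<open>m\<close>, so only
  the terms at \<open>m * a\<close> survive, and for these the exponents can be lowered.\<close>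

lemma num_coloured_mary_partitions_eq_sum_shift:
  assumes "m \<ge> 2" "r < m" "k 0 = Suc K"
  shows "num_coloured_mary_partitions m k (r + m * n) =
         (\<Sum>a\<le>n. ((K + r + m * (n - a)) choose K) * num_coloured_mary_partitions m (k \<circ> Suc) a)"
proof -
  let ?c = "num_coloured_mary_partitions m (k(0 := 0))"
  let ?N = "r + m * n"
  have "k = k(0 := Suc K)" using assms by auto
  then have "num_coloured_mary_partitions m k ?N = (\<Sum>a\<le>?N. ((K + (?N - a)) choose K) * ?c a)"
    using num_coloured_mary_partitions_eq_sum[OF assms(1), of k K ?N] by simp
  also have "\<dots> = (\<Sum>a\<in>(*) m ` {..n}. ((K + (?N - a)) choose K) * ?c a)"
  proof (rule sum.mono_neutral_right)
    show "(*) m ` {..n} \<subseteq> {..?N}"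
      by (auto intro: trans_le_add2)
    show "\<forall>a\<in>{..?N} - (*) m ` {..n}. ((K + (?N - a)) choose K) * ?c a = 0"
    proof
      fix a assume a: "a \<in> {..?N} - (*) m ` {..n}"
      have "\<not> m dvd a"
      proof
        assume "m dvd a"
        then obtain b where b: "a = m * b" ..
        \<comment> \<open>Here \<open>r < m\<close> enters: no multiple of \<open>m\<close> lies
          strictly between \<open>m * n\<close> and \<open>?N + 1\<close> .\<close>
        with a have "m * b < m * Suc n" using assms(2) by simp
        then have "b \<le> n" by (simp only: mult_less_cancel1) simp
        then show False using a b by blast
      qed
      then show "((K + (?N - a)) choose K) * ?c a = 0"
        by (simp add: num_coloured_mary_partitions_not_dvd)
    qed
  qed simp
  also have "\<dots> = (\<Sum>a\<le>n. ((K + (?N - m * a)) choose K) * ?c (m * a))"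
    using assms(1) by (subst sum.reindex) (auto simp: inj_on_def)
  also have "\<dots> = (\<Sum>a\<le>n. ((K + r + m * (n - a)) choose K) *
      num_coloured_mary_partitions m (k \<circ> Suc) a)"
  proof (intro sum.cong refl)
    fix a assume "a \<in> {..n}"
    then obtain b where "n = a + b" by (auto dest: le_Suc_ex)
    then have "K + (?N - m * a) = K + r + m * (n - a)"
      by (simp add: distrib_left)
    moreover have "?c (m * a) = num_coloured_mary_partitions m (k \<circ> Suc) a"
      using num_coloured_mary_partitions_shift[of m "k(0 := 0)" a] assms(1)
      by (simp add: comp_def)
    ultimately show "((K + (?N - m * a)) choose K) * ?c (m * a) =
        ((K + r + m * (n - a)) choose K) * num_coloured_mary_partitions m (k \<circ> Suc) a"
      by (simp only:)
  qed
  finally show ?thesis .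
qed

section \<open>Binomial coefficients modulo \<open>m\<close>\<close>

lemma fact_mult_binomial_eq_prod: "fact K * ((K + x) choose K) = (\<Prod>i<K. Suc (i + x))"
proof (induction K)
  case (Suc K)
  have "fact (Suc K) * ((Suc K + x) choose Suc K) =
      fact K * ((Suc (K + x) choose Suc K) * Suc K)"
    by (simp add: algebra_simps)
  also have "\<dots> = Suc (K + x) * (fact K * ((K + x) choose K))"
    by (simp only: Suc_times_binomial_eq [symmetric]) (simp only: mult_ac)
  finally show ?case
    using Suc by (simp add: mult_ac)
qed simp

text \<open>After multiplication by \<open>fact K\<close> the binomial coefficient is a product of
  integers shifted by \<open>x\<close>, so only the residue of \<open>x\<close> matters;
  \<open>fact K\<close> can be cancelled modulo \<open>m\<close>.\<close>

lemma cong_binomial_coprime_fact: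
  fixes m :: nat
  assumes "coprime m (fact K)" "[x = y] (mod m)"
  shows "[(K + x) choose K = (K + y) choose K] (mod m)"
proof -
  have "[(\<Prod>i<K. Suc (i + x)) = (\<Prod>i<K. Suc (i + y))] (mod m)"
    using cong_add[OF cong_refl assms(2)] by (intro cong_prod) (metis add_Suc)
  then have "[fact K * ((K + x) choose K) = fact K * ((K + y) choose K)] (mod m)"
    by (simp only: fact_mult_binomial_eq_prod)
  then show ?thesis
    using assms(1) by (metis cong_mult_lcancel_nat coprime_commute)
qed

section \<open>Removing the digits one by one\<close>

text \<open>The binomial coefficient is constant modulo \<open>m\<close> and leaves the sum; the sum
  of the shifted counts is absorbed into one more colour for the part \<open>1\<close>.\<close>

lemma num_coloured_mary_partitions_cong:
  assumes "m \<ge> 2" "r < m" "k 0 = Suc K" "coprime m (fact K)"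
  shows "[num_coloured_mary_partitions m k (r + m * n) = ((K + r) choose K) *
          num_coloured_mary_partitions m ((k \<circ> Suc)(0 := Suc (k 1))) n] (mod m)"
proof -
  let ?c = "num_coloured_mary_partitions m (k \<circ> Suc)"
  have "[(K + (r + m * (n - a))) choose K = (K + r) choose K] (mod m)" for a
    using assms(4) by (intro cong_binomial_coprime_fact) (simp_all add: cong_def)
  then have "[num_coloured_mary_partitions m k (r + m * n) =
      (\<Sum>a\<le>n. ((K + r) choose K) * ?c a)] (mod m)"
    unfolding num_coloured_mary_partitions_eq_sum_shift[of m r k K n, OF assms(1-3)]
    by (intro cong_sum cong_mult cong_refl) (simp add: add.assoc)
  moreover have "(k \<circ> Suc)(0 := k 1) = k \<circ> Suc" by auto
  ultimately show ?thesis
    using num_coloured_mary_partitions_add_colour[OF assms(1), of "k \<circ> Suc" "k 1" n]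
    by (simp add: sum_distrib_left)
qed

theorem corollary2p2:
  fixes m n t :: nat and k d :: "nat \<Rightarrow> nat"
  assumes "m \<ge> 2"
    and "\<And>j. k j > 0"
    and "n = (\<Sum>j=0..t. d j * m ^ j)"
    and "\<And>j. j \<le> t \<Longrightarrow> d j \<le> m - 1"
    and "coprime m (fact (k 0 - 1))"
    and "\<And>j. j \<ge> 1 \<Longrightarrow> coprime m (fact (k j))"
  shows "[num_coloured_mary_partitions m k n =
          ((k 0 - 1 + d 0) choose (k 0 - 1)) * (\<Prod>j=1..t. (k j + d j) choose (k j))] (mod m)"
  using assms(2-)
\<comment> \<open>The colours vary as well, since removing the lowest digit changes the colour
  sequence.\<close>
proof (induction t arbitrary: n k d)
  case 0
  have "d 0 < m" using "0.prems"(3)[of 0] assms(1) by simp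
  then have "[num_coloured_mary_partitions m k (d 0 + m * 0) = ((k 0 - 1 + d 0) choose (k 0 - 1)) *
      num_coloured_mary_partitions m ((k \<circ> Suc)(0 := Suc (k 1))) 0] (mod m)"
    using "0.prems"(1)[of 0] "0.prems"(4) by (intro num_coloured_mary_partitions_cong assms(1)) simp_all
  then show ?case
    using "0.prems"(2) assms(1) by (simp add: num_coloured_mary_partitions_0)
next
  case (Suc t)
  \<comment> \<open>As \<open>k' 0 - 1 = k 1\<close>, the special factor at index \<open>0\<close>
    for \<open>k'\<close> is the ordinary factor at index \<open>1\<close> for \<open>k\<close>, and
    the coprimality required of \<open>fact (k' 0 - 1)\<close> is the one assumed for
    \<open>fact (k 1)\<close>.\<close>
  define k' where "k' = (k \<circ> Suc)(0 := Suc (k 1))"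
  define n' where "n' = (\<Sum>j=0..t. d (Suc j) * m ^ j)"
  have n: "n = d 0 + m * n'"
    unfolding Suc.prems(2) n'_def
    by (subst sum.atLeast0_atMost_Suc_shift) (simp add: sum_distrib_left mult_ac)
  have "d 0 < m" using Suc.prems(3)[of 0] assms(1) by simp
  then have first_digit: "[num_coloured_mary_partitions m k n = ((k 0 - 1 + d 0) choose (k 0 - 1)) *
      num_coloured_mary_partitions m k' n'] (mod m)"
    unfolding n k'_def using Suc.prems(1)[of 0] Suc.prems(4)
    by (intro num_coloured_mary_partitions_cong assms(1)) simp_all
  have other_digits: "[num_coloured_mary_partitions m k' n' = ((k' 0 - 1 + (d \<circ> Suc) 0) choose (k' 0 - 1)) *
      (\<Prod>j=1..t. (k' j + (d \<circ> Suc) j) choose (k' j))] (mod m)"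
    proof (rule Suc.IH)
    show "n' = (\<Sum>j=0..t. (d \<circ> Suc) j * m ^ j)"
      by (simp add: n'_def)
    show "k' j > 0" for j
      using Suc.prems(1) by (simp add: k'_def)
    show "(d \<circ> Suc) j \<le> m - 1" if "j \<le> t" for j
      using Suc.prems(3) that by simp
    show "coprime m (fact (k' 0 - 1))"
      using Suc.prems(5) by (simp add: k'_def)
    show "coprime m (fact (k' j))" if "j \<ge> 1" for j
      using Suc.prems(5) that by (simp add: k'_def)
  qed
  have prod: "((k' 0 - 1 + (d \<circ> Suc) 0) choose (k' 0 - 1)) *
      (\<Prod>j=1..t. (k' j + (d \<circ> Suc) j) choose (k' j)) = (\<Prod>j=1..Suc t. (k j + d j) choose (k j))"
  proof -
    have "(\<Prod>j=1..Suc t. (k j + d j) choose (k j)) =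
        (\<Prod>j=0..t. (k (Suc j) + d (Suc j)) choose (k (Suc j)))"
      using prod.shift_bounds_cl_Suc_ivl[of "\<lambda>j. (k j + d j) choose (k j)" 0 t] by simp
    also have "\<dots> = ((k 1 + d 1) choose (k 1)) *
        (\<Prod>j=1..t. (k (Suc j) + d (Suc j)) choose (k (Suc j)))"
      by (subst prod.atLeast_Suc_atMost) simp_all
    finally show ?thesis
      by (simp add: k'_def)
  qed
  show ?case
    using cong_trans[OF first_digit cong_scalar_left[OF other_digits]] unfolding prod .
qed

end
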